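(* Let $\mathcal{H}$ be a Hilbert space. Then $\mathfrak{X}^+=\mathfrak{Y}$.
   Context: $L(\mathcal{H})$ is the algebra of bounded linear operators on $\mathcal{H}$ and $\mathcal{P}=\{P\in L(\mathcal{H}):P^2=P=P^*\}$. $\mathfrak{X}=\{PQ:P,Q\in\mathcal{P}\}$ and $\mathfrak{Y}=\{PQP:P,Q\in\mathcal{P}\}$. For $C\in L(\mathcal{H})$, $|C|=(C^*C)^{1/2}$. $\mathfrak{X}^+$ is the set of positive operators $A\in L(\mathcal{H})$ for which there exists $T\in\mathfrak{X}$ with $A=|T^*|=(TT^* )^{1/2}$. *)

theory Defs
  imports "HOL-Analysis.Analysis"
begin

text \<open>
  The scalars are real or complex. Every element \<open>x\<close> of a field of the following class is a root
  of the real polynomial \<open>t\<^sup>2 - 2 (sc_re x) t + (norm x)\<^sup>2\<close>, so the field is a copy of the real numbers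
  (with \<open>sc_cnj\<close> the identity) or of the complex numbers (with \<open>sc_cnj\<close> complex conjugation).
\<close>

class real_or_complex = real_normed_field +
  fixes sc_cnj :: "'a \<Rightarrow> 'a"
    and sc_re :: "'a \<Rightarrow> real"
  assumes sc_cnj_add: "sc_cnj (x + y) = sc_cnj x + sc_cnj y"
    and sc_cnj_mult: "sc_cnj (x * y) = sc_cnj x * sc_cnj y"
    and sc_cnj_scaleR: "sc_cnj (r *\<^sub>R x) = r *\<^sub>R sc_cnj x"
    and sc_cnj_cnj: "sc_cnj (sc_cnj x) = x"
    and sc_add_cnj: "x + sc_cnj x = (2 * sc_re x) *\<^sub>R 1"
    and sc_mult_cnj: "x * sc_cnj x = (norm x)\<^sup>2 *\<^sub>R 1"

instantiation real :: real_or_complex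
begin

definition sc_cnj_real :: "real \<Rightarrow> real" where "sc_cnj_real x = x"
definition sc_re_real :: "real \<Rightarrow> real" where "sc_re_real x = x"

instance
  by standard (simp_all add: sc_cnj_real_def sc_re_real_def power2_eq_square)

end

instantiation complex :: real_or_complex
begin

definition sc_cnj_complex :: "complex \<Rightarrow> complex" where "sc_cnj_complex = cnj"
definition sc_re_complex :: "complex \<Rightarrow> real" where "sc_re_complex = Re"

instance
proof
  fix x y :: complex and r :: real
  show "sc_cnj (x + y) = sc_cnj x + sc_cnj y"
    and "sc_cnj (x * y) = sc_cnj x * sc_cnj y"
    and "sc_cnj (r *\<^sub>R x) = r *\<^sub>R sc_cnj x"
    and "sc_cnj (sc_cnj x) = x"
    by (simp_all add: sc_cnj_complex_def)
  show "x + sc_cnj x = (2 * sc_re x) *\<^sub>R 1"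
    by (simp add: sc_cnj_complex_def sc_re_complex_def complex_add_cnj scaleR_conv_of_real)
  show "x * sc_cnj x = (norm x)\<^sup>2 *\<^sub>R 1"
    by (simp add: sc_cnj_complex_def complex_mult_cnj cmod_power2 scaleR_conv_of_real)
qed

end

text \<open>
  The type class \<^class>\<open>real_inner\<close> only provides a real inner product. A Hilbert space over
  \<open>'k\<close> is given here by its \<open>'k\<close>-valued inner product \<open>ip\<close> (linear in the first argument) and
  its scalar multiplication, while the type-class structure of \<open>'a\<close> is that of the underlying
  real Hilbert space, with inner product the real part of \<open>ip\<close>; so the norm and completeness
  are those of \<open>ip\<close>.
\<close>

locale hilbert_space = vector_space scale
  for scale :: "'k::real_or_complex \<Rightarrow> 'a::{real_inner, complete_space} \<Rightarrow> 'a" +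
  fixes ip :: "'a \<Rightarrow> 'a \<Rightarrow> 'k"
  assumes scale_of_real: "scale (of_real r) x = r *\<^sub>R x"
    and ip_add_left: "ip (x + y) z = ip x z + ip y z"
    and ip_scale_left: "ip (scale c x) y = c * ip x y"
    and ip_commute: "ip y x = sc_cnj (ip x y)"
    and re_ip: "sc_re (ip x y) = x \<bullet> y"
begin

definition bounded_ops :: "('a \<Rightarrow> 'a) set" where
  "bounded_ops = {C. Vector_Spaces.linear scale scale C \<and> (\<exists>K. \<forall>x. norm (C x) \<le> K * norm x)}"

definition adj :: "('a \<Rightarrow> 'a) \<Rightarrow> 'a \<Rightarrow> 'a" where
  "adj C = (THE D. D \<in> bounded_ops \<and> (\<forall>x y. ip (C x) y = ip x (D y)))"

text \<open>
  Self-adjointness has to be required over the reals. It makes \<open>ip (A x) x\<close> a real scalar,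
  so passing to its real part loses nothing.
\<close>

definition positive_op :: "('a \<Rightarrow> 'a) \<Rightarrow> bool" where
  "positive_op A \<longleftrightarrow> A \<in> bounded_ops \<and> adj A = A \<and> (\<forall>x. 0 \<le> sc_re (ip (A x) x))"

definition op_sqrt :: "('a \<Rightarrow> 'a) \<Rightarrow> 'a \<Rightarrow> 'a" where
  "op_sqrt A = (THE R. positive_op R \<and> R \<circ> R = A)"

definition op_abs :: "('a \<Rightarrow> 'a) \<Rightarrow> 'a \<Rightarrow> 'a" where
  "op_abs C = op_sqrt (adj C \<circ> C)"

definition projections :: "('a \<Rightarrow> 'a) set" where
  "projections = {P \<in> bounded_ops. P \<circ> P = P \<and> adj P = P}"

definition proj_products :: "('a \<Rightarrow> 'a) set" where
  "proj_products = {P \<circ> Q | P Q. P \<in> projections \<and> Q \<in> projections}"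

definition proj_triple_products :: "('a \<Rightarrow> 'a) set" where
  "proj_triple_products = {P \<circ> Q \<circ> P | P Q. P \<in> projections \<and> Q \<in> projections}"

definition proj_products_plus :: "('a \<Rightarrow> 'a) set" where
  "proj_products_plus = {A. positive_op A \<and> (\<exists>T \<in> proj_products. A = op_abs (adj T))}"

end

lemma hilbert_space_real:
  "hilbert_space (*\<^sub>R) ((\<bullet>) :: 'a \<Rightarrow> 'a::{real_inner, complete_space} \<Rightarrow> real)"
proof unfold_locales
  fix x y :: 'a
  show "y \<bullet> x = sc_cnj (x \<bullet> y)"
    by (simp only: sc_cnj_real_def inner_commute)
qed (simp_all add: scaleR_right_distrib scaleR_left_distrib inner_add_left sc_re_real_def)

lemma hilbert_space_complex:
  "hilbert_space (*) (\<lambda>x y :: complex. x * cnj y)"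
  by unfold_locales
    (simp_all add: distrib_left distrib_right scaleR_conv_of_real inner_complex_def
      sc_cnj_complex_def sc_re_complex_def)

end

theory Submission
  imports Defs
begin

text \<open>
  Relative to \<open>H = ran P \<oplus> ker P\<close> write \<open>A = P Q P\<close> on \<open>ran P\<close> and let \<open>X\<^sup>* = (1 - P) Q P\<close> be the
  off-diagonal corner of \<open>Q\<close>, so \<open>X X\<^sup>* = A - A\<^sup>2\<close>. If a second operator \<open>B\<close> is to be compressed
  from a projection \<open>Q'\<close>, then \<open>Q'\<close> needs a corner \<open>(B - B\<^sup>2)\<^sup>1\<^sup>/\<^sup>2 V\<close>, where \<open>V\<close> is the polar part of \<open>X\<close>.
  For \<open>B = A\<^sup>2\<close> or \<open>B\<^sup>2 = A\<close> the polar part can be avoided: up to an invertible factor, the range of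
  \<open>Q'\<close> is spanned by vectors \<open>D x + Y x\<close> with \<open>Y x\<close> in terms of \<open>X\<^sup>*\<close> and \<open>D\<close> the square root of a
  polynomial. So \<open>Q'\<close> is the orthogonal projection onto the closure of these vectors, and the
  square root of a compression and the square of a compression are again compressions.
\<close>

subsection \<open>Riesz representation and positive square roots\<close>

text \<open>
  The representing vector minimises \<open>\<parallel>x\<parallel>\<^sup>2 - 2 f x\<close> over \<open>M\<close>. The whole space yields adjoints, and
  \<open>f = (\<bullet>) x\<close> yields orthogonal projections.
\<close>
lemma riesz_closed_subspace:
  fixes M :: "'a::{real_inner, complete_space} set" and f :: "'a \<Rightarrow> real"
  assumes f: "bounded_linear f" and M: "subspace M" "closed M"
  obtains w where "w \<in> M" "\<And>m. m \<in> M \<Longrightarrow> w \<bullet> m = f m"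
proof -
  interpret f: bounded_linear f by fact
  define \<phi> where "\<phi> x = (norm x)\<^sup>2 - 2 * f x" for x
  obtain K where K: "\<And>x. norm (f x) \<le> norm x * K" using f.bounded by auto
  have lower: "- K\<^sup>2 \<le> \<phi> x" for x
  proof -
    have "f x \<le> norm x * K" using K[of x] by simp
    moreover have "0 \<le> (norm x - K)\<^sup>2" by simp
    ultimately show ?thesis unfolding \<phi>_def power2_diff by (simp add: algebra_simps)
  qed
  define d where "d = Inf (\<phi> ` M)"
  have "0 \<in> M" using M(1) by (rule subspace_0)
  then have ne: "\<phi> ` M \<noteq> {}" by auto
  have bdd: "bdd_below (\<phi> ` M)" using lower by (auto intro!: bdd_belowI)
  have d_le: "d \<le> \<phi> m" if "m \<in> M" for m
    unfolding d_def using bdd that by (intro cInf_lower) auto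
  have "\<exists>m\<in>M. \<phi> m < d + 1 / real (Suc n)" for n
    using cInf_lessD[OF ne, of "d + 1 / real (Suc n)"] by (auto simp: d_def)
  then obtain s where s: "\<And>n. s n \<in> M" "\<And>n. \<phi> (s n) < d + 1 / real (Suc n)"
    by metis
  \<comment> \<open>The midpoint of \<open>x\<close> and \<open>y\<close> lies in \<open>M\<close>,
    so \<open>d\<close> bounds \<open>\<phi>\<close> there; \<open>f\<close> is linear, so the
    parallelogram law for the norm carries over to \<open>\<phi>\<close>. Hence minimising sequences
    are Cauchy.\<close>
  have parallelogram: "(norm (x - y))\<^sup>2 \<le> 2 * (\<phi> x - d) + 2 * (\<phi> y - d)" if "x \<in> M" "y \<in> M" for x y
  proof -
    have "(1/2) *\<^sub>R (x + y) \<in> M" using M(1) that by (intro subspace_scale subspace_add)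
    from d_le[OF this] have "4 * d \<le> 4 * \<phi> ((1/2) *\<^sub>R (x + y))" by simp
    also have "\<dots> = 2 * \<phi> x + 2 * \<phi> y - (norm (x - y))\<^sup>2"
      unfolding \<phi>_def power2_norm_eq_inner
      by (simp add: f.add f.scaleR inner_add_left inner_add_right inner_diff_left inner_diff_right
          inner_commute algebra_simps)
    finally show ?thesis by simp
  qed
  have "Cauchy s"
  proof (rule metric_CauchyI)
    fix e :: real assume e: "0 < e"
    obtain N where N: "1 / real (Suc N) < e\<^sup>2 / 4"
      using reals_Archimedean[of "e\<^sup>2 / 4"] e by (auto simp: inverse_eq_divide)
    have bnd: "\<phi> (s n) - d < e\<^sup>2 / 4" if "n \<ge> N" for n
    proof -
      have "1 / real (Suc n) \<le> 1 / real (Suc N)" using that by (intro divide_left_mono) auto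
      with s(2)[of n] N show ?thesis by linarith
    qed
    have "dist (s m) (s n) < e" if "m \<ge> N" "n \<ge> N" for m n
    proof -
      have "(norm (s m - s n))\<^sup>2 < e\<^sup>2"
      proof -
        have "2 * (\<phi> (s m) - d) + 2 * (\<phi> (s n) - d) < 2 * (e\<^sup>2 / 4) + 2 * (e\<^sup>2 / 4)"
          by (intro add_strict_mono mult_strict_left_mono bnd that) auto
        also have "\<dots> = e\<^sup>2" by simp
        finally show ?thesis using parallelogram[OF s(1)[of m] s(1)[of n]] by (rule le_less_trans[rotated])
      qed
      then show ?thesis using e by (simp add: dist_norm power_less_imp_less_base)
    qed
    then show "\<exists>M. \<forall>m\<ge>M. \<forall>n\<ge>M. dist (s m) (s n) < e" by blast
  qed
  then obtain w where w: "s \<longlonglongrightarrow> w" by (meson Cauchy_convergent convergent_def)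
  have wM: "w \<in> M" using closed_sequentially[OF M(2)] s(1) w by blast
  have "(\<lambda>n. \<phi> (s n)) \<longlonglongrightarrow> \<phi> w"
    unfolding \<phi>_def by (intro tendsto_intros f.tendsto w)
  moreover have "(\<lambda>n. d + 1 / real (Suc n)) \<longlonglongrightarrow> d + 0"
    by (intro tendsto_intros LIMSEQ_Suc[OF lim_1_over_n])
  ultimately have "\<phi> w \<le> d + 0"
    by (rule LIMSEQ_le) (use s(2) less_imp_le in blast)
  then have \<phi>w: "\<phi> w \<le> \<phi> m" if "m \<in> M" for m using d_le[OF that] by simp
  have "w \<bullet> m = f m" if m: "m \<in> M" for m
  proof (rule ccontr)
    assume "w \<bullet> m \<noteq> f m"
    define \<delta> where "\<delta> = w \<bullet> m - f m"
    have \<delta>: "\<delta> \<noteq> 0" using \<open>w \<bullet> m \<noteq> f m\<close> by (simp add: \<delta>_def)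
    \<comment> \<open>Along \<open>w + t *\<^sub>R m\<close> the functional changes by
      \<open>2 * t * \<delta> + t\<^sup>2 * (m \<bullet> m)\<close>. The added 1 keeps the
      denominator positive when \<open>m = 0\<close>, and \<open>t = - \<delta> / p\<close> makes
      the change negative.\<close>
    define p where "p = m \<bullet> m + 1"
    have pos: "p > 0" by (simp add: p_def add_nonneg_pos)
    define t where "t = - \<delta> / p"
    have "w + t *\<^sub>R m \<in> M" using M(1) wM m by (intro subspace_add subspace_scale)
    from \<phi>w[OF this] have "0 \<le> 2 * t * \<delta> + t\<^sup>2 * (m \<bullet> m)"
      unfolding \<phi>_def power2_norm_eq_inner \<delta>_def
      by (simp add: f.add f.scaleR inner_add_left inner_add_right inner_commute
          power2_eq_square algebra_simps)
    also have "\<dots> \<le> 2 * t * \<delta> + t\<^sup>2 * p" by (simp add: p_def algebra_simps)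
    also have "\<dots> = - \<delta>\<^sup>2 / p"
      using pos by (simp add: t_def field_simps power2_eq_square)
    also have "\<dots> < 0" using \<delta> pos by simp
    finally show False by simp
  qed
  with wM that show thesis by blast
qed

section \<open>Positive symmetric operators and the square root iteration\<close>

lemma positive_form_bound:
  fixes S :: "'a::real_inner \<Rightarrow> 'a"
  assumes S: "linear S" and sym: "\<And>x y. S x \<bullet> y = x \<bullet> S y" and pos: "\<And>x. 0 \<le> S x \<bullet> x"
    and K: "0 < K" "\<And>x. norm (S x) \<le> K * norm x"
  shows "(norm (S x))\<^sup>2 \<le> K * (S x \<bullet> x)"
proof -
  interpret S: linear S by fact
  \<comment> \<open>Positivity is tested at \<open>x - t *\<^sub>R S x\<close>; the value
    \<open>1 / K\<close> optimises the resulting quadratic estimate.\<close>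
  define t where "t = 1 / K"
  have "S (S x) \<bullet> S x \<le> norm (S (S x)) * norm (S x)" by (rule norm_cauchy_schwarz)
  also have "\<dots> \<le> K * norm (S x) * norm (S x)" by (intro mult_right_mono K) simp
  finally have "t\<^sup>2 * (S (S x) \<bullet> S x) \<le> t\<^sup>2 * (K * (norm (S x))\<^sup>2)"
    by (intro mult_left_mono) (simp_all add: power2_eq_square)
  moreover have "0 \<le> S x \<bullet> x - 2 * t * (norm (S x))\<^sup>2 + t\<^sup>2 * (S (S x) \<bullet> S x)"
    using pos[of "x - t *\<^sub>R S x"] sym[of "S x" x] unfolding power2_norm_eq_inner
    by (simp add: S.diff S.scale inner_diff_left inner_diff_right algebra_simps power2_eq_square inner_commute)
  ultimately have "2 * t * (norm (S x))\<^sup>2 \<le> S x \<bullet> x + t\<^sup>2 * (K * (norm (S x))\<^sup>2)" by linarith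
  then have "(norm (S x))\<^sup>2 / K \<le> S x \<bullet> x"
    using K(1) by (simp add: t_def power2_eq_square)
  then show ?thesis using K(1) by (simp add: field_simps)
qed

lemma positive_form_zero:
  fixes S :: "'a::real_inner \<Rightarrow> 'a"
  assumes S: "bounded_linear S" and sym: "\<And>x y. S x \<bullet> y = x \<bullet> S y" and pos: "\<And>x. 0 \<le> S x \<bullet> x"
    and "S x \<bullet> x = 0"
  shows "S x = 0"
proof -
  interpret S: bounded_linear S by fact
  obtain K where "0 < K" "\<And>x. norm (S x) \<le> norm x * K" using S.pos_bounded by blast
  then have "(norm (S x))\<^sup>2 \<le> K * (S x \<bullet> x)"
    using positive_form_bound[OF S.linear_axioms sym pos, of K x] by (simp add: mult.commute)
  with assms(4) show ?thesis by simp
qed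

text \<open>
  If \<open>S\<close> is a positive contraction, the iterates for \<open>T = 1 - S\<close> converge to a solution of
  \<open>Y = (T + Y\<^sup>2) / 2\<close>, that is \<open>(1 - Y)\<^sup>2 = S\<close>. The increments are dominated by those of the
  scalar iteration for \<open>T = 1\<close>, which is increasing and bounded.
\<close>
primrec sqrt_iter :: "('a::real_vector \<Rightarrow> 'a) \<Rightarrow> nat \<Rightarrow> 'a \<Rightarrow> 'a" where
  "sqrt_iter T 0 = (\<lambda>x. 0)"
| "sqrt_iter T (Suc n) = (\<lambda>x. (1/2) *\<^sub>R (T x + sqrt_iter T n (sqrt_iter T n x)))"

primrec sqrt_iter_bound :: "nat \<Rightarrow> real" where
  "sqrt_iter_bound 0 = 0"
| "sqrt_iter_bound (Suc n) = (1 + (sqrt_iter_bound n)\<^sup>2) / 2"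

lemma sqrt_iter_bound_range: "0 \<le> sqrt_iter_bound n" "sqrt_iter_bound n \<le> 1"
proof (induction n)
  case (Suc n)
  { case 1 show ?case by simp }
  { case 2 show ?case using power_le_one[OF Suc.IH, of 2] by simp }
qed auto

lemma sqrt_iter_bound_Suc: "sqrt_iter_bound n \<le> sqrt_iter_bound (Suc n)"
proof -
  have "0 \<le> (1 - sqrt_iter_bound n)\<^sup>2" by simp
  then show ?thesis by (simp add: power2_diff)
qed

lemma sqrt_iter_bound_mono: "m \<le> n \<Longrightarrow> sqrt_iter_bound m \<le> sqrt_iter_bound n"
  by (rule lift_Suc_mono_le[of sqrt_iter_bound, OF sqrt_iter_bound_Suc])

lemma sqrt_iter_bound_Cauchy: "Cauchy sqrt_iter_bound"
proof (rule convergent_Cauchy)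
  have "\<bar>sqrt_iter_bound n\<bar> \<le> 1" for n using sqrt_iter_bound_range[of n] by simp
  then have "Bseq sqrt_iter_bound" by (intro BseqI'[of _ 1]) simp
  then show "convergent sqrt_iter_bound"
    by (intro Bseq_mono_convergent) (auto intro: sqrt_iter_bound_mono)
qed

text \<open>Each iterate is a polynomial in \<open>T\<close>. The cases of interest are
  \<open>C = T\<close>, \<open>C\<close> another iterate, and \<open>C\<close> in the commutant of
  the operator whose root is sought.\<close>

lemma sqrt_iter_commute:
  assumes C: "linear C" and "\<And>x. C (T x) = T (C x)"
  shows "C (sqrt_iter T n x) = sqrt_iter T n (C x)"
proof (induction n arbitrary: x)
  case 0 show ?case using linear_0[OF C] by simp
next
  case (Suc n) show ?case using assms(2) by (simp add: linear_cmul[OF C] linear_add[OF C] Suc.IH)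
qed

lemma sqrt_iter_linear:
  assumes "linear T" shows "linear (sqrt_iter T n)"
proof (induction n)
  case 0 show ?case by (simp add: linear_zero)
next
  case (Suc n)
  have "linear (\<lambda>x. sqrt_iter T n (sqrt_iter T n x))"
    using linear_compose[OF Suc Suc] by (simp add: o_def)
  with assms show ?case by (simp add: linear_compose_add linear_compose_scale_right)
qed

lemma sqrt_iter_norm:
  fixes T :: "'a::real_normed_vector \<Rightarrow> 'a"
  assumes "\<And>x. norm (T x) \<le> norm x"
  shows "norm (sqrt_iter T n x) \<le> sqrt_iter_bound n * norm x"
proof (induction n arbitrary: x)
  case (Suc n)
  have "norm (sqrt_iter T n (sqrt_iter T n x)) \<le> sqrt_iter_bound n * (sqrt_iter_bound n * norm x)"
    by (rule order_trans[OF Suc mult_left_mono[OF Suc sqrt_iter_bound_range(1)]])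
  then have "norm (T x + sqrt_iter T n (sqrt_iter T n x)) \<le> norm x + (sqrt_iter_bound n)\<^sup>2 * norm x"
    using assms[of x] by (intro order_trans[OF norm_triangle_ineq]) (simp add: power2_eq_square mult.assoc)
  moreover have "norm (sqrt_iter T (Suc n) x) = norm (T x + sqrt_iter T n (sqrt_iter T n x)) / 2" by simp
  moreover have "sqrt_iter_bound (Suc n) * norm x = (norm x + (sqrt_iter_bound n)\<^sup>2 * norm x) / 2"
    by (simp add: field_simps)
  ultimately show ?case by (simp only: divide_right_mono zero_le_numeral)
qed auto

text \<open>Consecutive iterates \<open>Y\<close> and \<open>Z\<close> commute, so
  \<open>Z\<^sup>2 - Y\<^sup>2 = (Z - Y) (Z + Y)\<close>, and the induction hypothesis applies at
  the vector \<open>Z x + Y x\<close>. The scalar bounds obey the same factorisation.\<close>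

lemma sqrt_iter_step:
  fixes T :: "'a::real_normed_vector \<Rightarrow> 'a"
  assumes T: "linear T" "\<And>x. norm (T x) \<le> norm x"
  shows "norm (sqrt_iter T (Suc n) x - sqrt_iter T n x)
    \<le> (sqrt_iter_bound (Suc n) - sqrt_iter_bound n) * norm x"
proof (induction n arbitrary: x)
  case 0 show ?case using T(2)[of x] by simp
next
  case (Suc n)
  let ?Y = "sqrt_iter T n" and ?Z = "sqrt_iter T (Suc n)"
  let ?y = "sqrt_iter_bound n" and ?z = "sqrt_iter_bound (Suc n)"
  note lin = sqrt_iter_linear[OF T(1)]
  have "?Z (T x) = T (?Z x)" for x using sqrt_iter_commute[OF T(1), of T "Suc n" x] by simp
  then have comm: "?Z (?Y x) = ?Y (?Z x)"
    using sqrt_iter_commute[OF lin, of "Suc n" T n x] by blast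
  have step: "sqrt_iter T (Suc (Suc n)) x - ?Z x = (1/2) *\<^sub>R (?Z (?Z x) - ?Y (?Y x))"
  proof -
    have "sqrt_iter T (Suc (Suc n)) x = (1/2) *\<^sub>R (T x + ?Z (?Z x))"
      by (simp only: sqrt_iter.simps(2))
    moreover have "?Z x = (1/2) *\<^sub>R (T x + ?Y (?Y x))" by simp
    ultimately have "sqrt_iter T (Suc (Suc n)) x - ?Z x
      = (1/2) *\<^sub>R (T x + ?Z (?Z x)) - (1/2) *\<^sub>R (T x + ?Y (?Y x))"
      by (rule arg_cong2[where f = "(-)"])
    then show ?thesis by (simp only: scaleR_diff_right[symmetric] add_diff_cancel_left)
  qed
  have "?Z (?Z x) - ?Y (?Y x) = ?Z (?Z x + ?Y x) - ?Y (?Z x + ?Y x)"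
    by (simp only: linear_add[OF lin] comm algebra_simps)
  then have "norm (?Z (?Z x) - ?Y (?Y x)) \<le> (?z - ?y) * norm (?Z x + ?Y x)"
    using Suc[of "?Z x + ?Y x"] by simp
  also have "\<dots> \<le> (?z - ?y) * (?z * norm x + ?y * norm x)"
    using sqrt_iter_bound_Suc[of n]
    by (intro mult_left_mono order_trans[OF norm_triangle_ineq] add_mono sqrt_iter_norm T(2)) auto
  also have "\<dots> = 2 * ((sqrt_iter_bound (Suc (Suc n)) - ?z) * norm x)"
  proof -
    have *: "2 * (sqrt_iter_bound (Suc (Suc n)) - ?z) = ?z\<^sup>2 - ?y\<^sup>2"
      by (simp add: diff_divide_distrib[symmetric])
    show ?thesis unfolding mult.assoc[symmetric] * by (simp only: power2_eq_square algebra_simps)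
  qed
  finally show ?case unfolding step by simp
qed

text \<open>The steps telescope, and the scalar sequence is monotone, so its increments add up to a
  distance. This passes the Cauchy property from scalars to vectors.\<close>

lemma sqrt_iter_dist:
  fixes T :: "'a::real_normed_vector \<Rightarrow> 'a"
  assumes T: "linear T" "\<And>x. norm (T x) \<le> norm x"
  shows "dist (sqrt_iter T m x) (sqrt_iter T n x) \<le> dist (sqrt_iter_bound m) (sqrt_iter_bound n) * norm x"
proof -
  have *: "norm (sqrt_iter T n x - sqrt_iter T m x) \<le> (sqrt_iter_bound n - sqrt_iter_bound m) * norm x"
    if "m \<le> n" for m n
    using that
  proof (induction n rule: dec_induct)
    case (step n)
    have "norm (sqrt_iter T (Suc n) x - sqrt_iter T m x)
      \<le> norm (sqrt_iter T (Suc n) x - sqrt_iter T n x) + norm (sqrt_iter T n x - sqrt_iter T m x)"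
      using norm_triangle_ineq[of "sqrt_iter T (Suc n) x - sqrt_iter T n x" "sqrt_iter T n x - sqrt_iter T m x"]
      by (simp only: diff_add_cancel add_diff_eq)
    also note add_mono[OF sqrt_iter_step[OF T] step.IH]
    finally show ?case by (simp only: algebra_simps)
  qed simp
  show ?thesis
  proof (cases "m \<le> n")
    case True
    then show ?thesis using *[OF True] sqrt_iter_bound_mono[OF True]
      by (simp add: dist_norm norm_minus_commute)
  next
    case False
    then have "n \<le> m" by simp
    then show ?thesis using *[OF \<open>n \<le> m\<close>] sqrt_iter_bound_mono[OF \<open>n \<le> m\<close>]
      by (simp add: dist_norm)
  qed
qed

section \<open>Existence and uniqueness of the positive square root\<close>

lemma contraction_sqrt_exists:
  fixes S :: "'a::{real_inner, complete_space} \<Rightarrow> 'a"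
  assumes S: "bounded_linear S" and sym: "\<And>x y. S x \<bullet> y = x \<bullet> S y" and pos: "\<And>x. 0 \<le> S x \<bullet> x"
    and contr: "\<And>x. norm (S x) \<le> norm x"
  obtains R where "bounded_linear R" "\<And>x y. R x \<bullet> y = x \<bullet> R y" "\<And>x. 0 \<le> R x \<bullet> x"
    "\<And>x. R (R x) = S x"
    "\<forall>C. bounded_linear C \<longrightarrow> C \<circ> S = S \<circ> C \<longrightarrow> C \<circ> R = R \<circ> C"
proof -
  interpret S: bounded_linear S by fact
  define T where "T x = x - S x" for x
  have T: "linear T"
    unfolding T_def by (intro linear_compose_sub linear_ident S.linear_axioms)
  have Tsym: "T x \<bullet> y = x \<bullet> T y" for x y
    by (simp add: T_def inner_diff_left inner_diff_right sym)
  \<comment> \<open>Expanding gives \<open>(norm x)\<^sup>2 - 2 * (S x \<bullet> x) + (norm (S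
    x))\<^sup>2\<close>, and for a positive contraction the last term is at most
    \<open>S x \<bullet> x\<close>.\<close>
  have Tnorm: "norm (T x) \<le> norm x" for x
  proof -
    have "(norm (S x))\<^sup>2 \<le> 1 * (S x \<bullet> x)"
      by (rule positive_form_bound[OF S.linear_axioms sym pos]) (simp_all add: contr)
    with pos[of x] have "(norm (T x))\<^sup>2 \<le> (norm x)\<^sup>2"
      unfolding T_def power2_norm_eq_inner
      by (simp add: inner_diff_left inner_diff_right inner_commute)
    then show ?thesis by (rule power2_le_imp_le) simp
  qed
  define Y where "Y x = lim (\<lambda>n. sqrt_iter T n x)" for x
  have lim: "(\<lambda>n. sqrt_iter T n x) \<longlonglongrightarrow> Y x" for x
  proof -
    have "Cauchy (\<lambda>n. sqrt_iter T n x)"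
    proof (rule metric_CauchyI)
      fix e :: real assume e: "0 < e"
      \<comment> \<open>The added 1 covers \<open>x = 0\<close>.\<close>
      then have "0 < e / (norm x + 1)" by (simp add: add_nonneg_pos)
      from metric_CauchyD[OF sqrt_iter_bound_Cauchy this] obtain N where
        N: "\<And>m n. N \<le> m \<Longrightarrow> N \<le> n \<Longrightarrow> dist (sqrt_iter_bound m) (sqrt_iter_bound n) < e / (norm x + 1)"
        by blast
      have "dist (sqrt_iter T m x) (sqrt_iter T n x) < e" if "N \<le> m" "N \<le> n" for m n
      proof -
        have "dist (sqrt_iter T m x) (sqrt_iter T n x) \<le> dist (sqrt_iter_bound m) (sqrt_iter_bound n) * norm x"
          by (rule sqrt_iter_dist[OF T Tnorm])
        also have "\<dots> \<le> dist (sqrt_iter_bound m) (sqrt_iter_bound n) * (norm x + 1)"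
          by (intro mult_left_mono) auto
        also have "\<dots> < e" using N[OF that] by (simp add: less_divide_eq add_nonneg_pos)
        finally show ?thesis .
      qed
      then show "\<exists>M. \<forall>m\<ge>M. \<forall>n\<ge>M. dist (sqrt_iter T m x) (sqrt_iter T n x) < e" by blast
    qed
    then show ?thesis unfolding Y_def by (simp add: Cauchy_convergent_iff convergent_LIMSEQ_iff)
  qed
  note lin = sqrt_iter_linear[OF T]
  have iter_norm: "norm (sqrt_iter T n x) \<le> norm x" for n x
    using sqrt_iter_norm[OF Tnorm, of n x] mult_right_mono[OF sqrt_iter_bound_range(2)[of n] norm_ge_zero[of x]]
    by simp
  have Yadd: "Y (x + y) = Y x + Y y" for x y
    by (rule LIMSEQ_unique[OF lim]) (simp add: linear_add[OF lin] tendsto_add lim)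
  have Yscale: "Y (r *\<^sub>R x) = r *\<^sub>R Y x" for r x
    by (rule LIMSEQ_unique[OF lim]) (simp add: linear_cmul[OF lin] tendsto_scaleR lim)
  have Ynorm: "norm (Y x) \<le> norm x" for x
    by (rule LIMSEQ_le_const2[OF tendsto_norm[OF lim]]) (use iter_norm in blast)
  have Y: "bounded_linear Y"
    by (rule bounded_linear_intro[where K = 1]) (simp_all add: Yadd Yscale Ynorm)
  have Ysym: "Y x \<bullet> y = x \<bullet> Y y" for x y
  proof -
    have "sqrt_iter T n x \<bullet> y = x \<bullet> sqrt_iter T n y" for n x y
      by (induction n arbitrary: x y) (simp_all add: inner_add_left inner_add_right Tsym)
    then have "(\<lambda>n. x \<bullet> sqrt_iter T n y) \<longlonglongrightarrow> Y x \<bullet> y"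
      using tendsto_inner[OF lim[of x] tendsto_const[of y]] by simp
    then show ?thesis by (rule LIMSEQ_unique) (intro tendsto_intros lim)
  qed
  have Yfix: "Y x = (1/2) *\<^sub>R (T x + Y (Y x))" for x
  proof -
    \<comment> \<open>Convergence is only pointwise, so the composed iterates are split at
      \<open>Y x\<close>; the uniform bound 1 on the iterates removes the error term.\<close>
    have "(\<lambda>n. sqrt_iter T n (sqrt_iter T n x - Y x)) \<longlonglongrightarrow> 0"
    proof (rule Lim_null_comparison)
      show "\<forall>\<^sub>F n in sequentially. norm (sqrt_iter T n (sqrt_iter T n x - Y x)) \<le> norm (sqrt_iter T n x - Y x)"
        using iter_norm by simp
      show "(\<lambda>n. norm (sqrt_iter T n x - Y x)) \<longlonglongrightarrow> 0"
        using lim[of x] by (simp add: LIM_zero tendsto_norm_zero)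
    qed
    from tendsto_add[OF this lim[of "Y x"]]
    have "(\<lambda>n. sqrt_iter T n (sqrt_iter T n x)) \<longlonglongrightarrow> Y (Y x)"
      by (simp add: linear_diff[OF lin])
    then have "(\<lambda>n. sqrt_iter T (Suc n) x) \<longlonglongrightarrow> (1/2) *\<^sub>R (T x + Y (Y x))"
      unfolding sqrt_iter.simps(2) by (intro tendsto_intros)
    with LIMSEQ_Suc[OF lim[of x]] show ?thesis by (rule LIMSEQ_unique)
  qed
  interpret Y: bounded_linear Y by (rule Y)
  \<comment> \<open>Positivity of \<open>R\<close> comes from \<open>Y\<close> being a contraction.
    As a pointwise limit of polynomials in \<open>T\<close>, \<open>Y\<close> is symmetric and
    commutes with whatever commutes with \<open>S\<close>.\<close>
  define R where "R x = x - Y x" for x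
  show thesis
  proof
    show "bounded_linear R"
      unfolding R_def by (intro bounded_linear_sub bounded_linear_ident Y)
    show "R x \<bullet> y = x \<bullet> R y" for x y
      by (simp add: R_def inner_diff_left inner_diff_right Ysym)
    show "0 \<le> R x \<bullet> x" for x
    proof -
      have "Y x \<bullet> x \<le> norm (Y x) * norm x" by (rule norm_cauchy_schwarz)
      also have "\<dots> \<le> norm x * norm x" by (intro mult_right_mono Ynorm) simp
      finally show ?thesis by (simp add: R_def inner_diff_left power2_norm_eq_inner[symmetric] power2_eq_square)
    qed
    show "R (R x) = S x" for x
    proof -
      have "2 *\<^sub>R Y x = T x + Y (Y x)" by (subst Yfix) simp
      then show ?thesis by (simp add: R_def Y.diff T_def scaleR_2 algebra_simps)
    qed
    show "\<forall>C. bounded_linear C \<longrightarrow> C \<circ> S = S \<circ> C \<longrightarrow> C \<circ> R = R \<circ> C"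
    proof (intro allI impI ext)
      fix C :: "'a \<Rightarrow> 'a" and x
      assume C: "bounded_linear C" and "C \<circ> S = S \<circ> C"
      then have comm: "C (S x) = S (C x)" for x by (simp add: fun_eq_iff)
      interpret C: bounded_linear C by (rule C)
      have "C (T x) = T (C x)" for x by (simp add: T_def C.diff comm)
      then have "(\<lambda>n. sqrt_iter T n (C x)) \<longlonglongrightarrow> C (Y x)"
        using C.tendsto[OF lim[of x]] by (simp add: sqrt_iter_commute[OF C.linear_axioms])
      then have "C (Y x) = Y (C x)" using lim by (rule LIMSEQ_unique)
      then show "(C \<circ> R) x = (R \<circ> C) x" by (simp add: R_def C.diff)
    qed
  qed
qed

text \<open>Dividing by a bound \<open>K\<close> reduces to contractions. The commutant clause is
  kept because it later yields uniqueness, homogeneity over \<open>'k\<close>, and commutation of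
  the root with the operators it is built from.\<close>

lemma positive_sqrt_exists:
  fixes S :: "'a::{real_inner, complete_space} \<Rightarrow> 'a"
  assumes S: "bounded_linear S" and sym: "\<And>x y. S x \<bullet> y = x \<bullet> S y" and pos: "\<And>x. 0 \<le> S x \<bullet> x"
  obtains R where "bounded_linear R" "\<And>x y. R x \<bullet> y = x \<bullet> R y" "\<And>x. 0 \<le> R x \<bullet> x"
    "\<And>x. R (R x) = S x"
    "\<forall>C. bounded_linear C \<longrightarrow> C \<circ> S = S \<circ> C \<longrightarrow> C \<circ> R = R \<circ> C"
proof -
  interpret S: bounded_linear S by fact
  obtain K where K: "0 < K" "\<And>x. norm (S x) \<le> norm x * K" using S.pos_bounded by blast
  define S' where "S' x = (1 / K) *\<^sub>R S x" for x
  have S': "bounded_linear S'"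
    unfolding S'_def by (intro bounded_linear_const_scaleR S)
  have S'_sym: "S' x \<bullet> y = x \<bullet> S' y" for x y by (simp add: S'_def sym)
  have S'_pos: "0 \<le> S' x \<bullet> x" for x using K(1) pos[of x] by (simp add: S'_def)
  have S'_norm: "norm (S' x) \<le> norm x" for x
    using K by (simp add: S'_def divide_le_eq)
  obtain R where R: "bounded_linear R" "\<And>x y. R x \<bullet> y = x \<bullet> R y" "\<And>x. 0 \<le> R x \<bullet> x"
    "\<And>x. R (R x) = S' x"
    "\<forall>C. bounded_linear C \<longrightarrow> C \<circ> S' = S' \<circ> C \<longrightarrow> C \<circ> R = R \<circ> C"
    by (rule contraction_sqrt_exists[OF S' S'_sym S'_pos S'_norm]) (rule that)
  interpret R: bounded_linear R by (rule R(1))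
  show thesis
  proof (rule that[of "\<lambda>x. sqrt K *\<^sub>R R x"])
    show "bounded_linear (\<lambda>x. sqrt K *\<^sub>R R x)" by (intro bounded_linear_const_scaleR R(1))
    show "(sqrt K *\<^sub>R R x) \<bullet> y = x \<bullet> (sqrt K *\<^sub>R R y)" for x y by (simp add: R(2))
    show "0 \<le> (sqrt K *\<^sub>R R x) \<bullet> x" for x using K(1) R(3) by simp
    show "sqrt K *\<^sub>R R (sqrt K *\<^sub>R R x) = S x" for x
      using K(1) by (simp add: R.scaleR R(4) S'_def)
    show "\<forall>C. bounded_linear C \<longrightarrow> C \<circ> S = S \<circ> C
      \<longrightarrow> C \<circ> (\<lambda>x. sqrt K *\<^sub>R R x) = (\<lambda>x. sqrt K *\<^sub>R R x) \<circ> C"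
    proof (intro allI impI)
      fix C :: "'a \<Rightarrow> 'a" assume C: "bounded_linear C" "C \<circ> S = S \<circ> C"
      interpret C: bounded_linear C by (rule C(1))
      have "C \<circ> S' = S' \<circ> C" using C(2) by (simp add: fun_eq_iff S'_def C.scaleR)
      with C(1) R(5) have "C \<circ> R = R \<circ> C" by blast
      then show "C \<circ> (\<lambda>x. sqrt K *\<^sub>R R x) = (\<lambda>x. sqrt K *\<^sub>R R x) \<circ> C"
        by (simp add: fun_eq_iff C.scaleR)
    qed
  qed
qed

text \<open>Any positive root \<open>U\<close> commutes with its own square, hence with the
  constructed root \<open>Q\<close>. For \<open>y = U x - Q x\<close> this gives
  \<open>U y + Q y = 0\<close>; both forms are nonnegative at \<open>y\<close>, so
  \<open>U y = Q y = 0\<close>, and then symmetry gives \<open>y \<bullet> y = 0\<close>.\<close>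

lemma positive_sqrt_unique:
  fixes R R' :: "'a::{real_inner, complete_space} \<Rightarrow> 'a"
  assumes R: "bounded_linear R" "\<And>x y. R x \<bullet> y = x \<bullet> R y" "\<And>x. 0 \<le> R x \<bullet> x"
    and R': "bounded_linear R'" "\<And>x y. R' x \<bullet> y = x \<bullet> R' y" "\<And>x. 0 \<le> R' x \<bullet> x"
    and eq: "\<And>x. R (R x) = R' (R' x)"
  shows "R = R'"
proof -
  have sq: "bounded_linear (\<lambda>x. R (R x))"
    by (intro bounded_linear_compose[OF R(1) R(1)])
  have sq_sym: "R (R x) \<bullet> y = x \<bullet> R (R y)" for x y by (simp add: R(2))
  have sq_pos: "0 \<le> R (R x) \<bullet> x" for x by (simp only: R(2)[of "R x" x] inner_ge_zero)
  obtain Q where Q: "bounded_linear Q" "\<And>x y. Q x \<bullet> y = x \<bullet> Q y" "\<And>x. 0 \<le> Q x \<bullet> x"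
    "\<And>x. Q (Q x) = R (R x)"
    "\<forall>C. bounded_linear C \<longrightarrow> C \<circ> (\<lambda>x. R (R x)) = (\<lambda>x. R (R x)) \<circ> C \<longrightarrow> C \<circ> Q = Q \<circ> C"
    by (rule positive_sqrt_exists[OF sq sq_sym sq_pos]) (rule that)
  have "U = Q" if U: "bounded_linear U" "\<And>x y. U x \<bullet> y = x \<bullet> U y" "\<And>x. 0 \<le> U x \<bullet> x"
    and UU: "\<And>x. U (U x) = R (R x)" for U
  proof
    fix x
    interpret U: bounded_linear U by (rule U(1))
    interpret Q: bounded_linear Q by (rule Q(1))
    have "U \<circ> (\<lambda>x. R (R x)) = (\<lambda>x. R (R x)) \<circ> U" by (simp add: fun_eq_iff flip: UU)
    with Q(5) U(1) have "U \<circ> Q = Q \<circ> U" by blast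
    then have comm: "U (Q x) = Q (U x)" for x by (simp add: fun_eq_iff)
    define y where "y = U x - Q x"
    have "U y + Q y = 0" by (simp add: y_def U.diff Q.diff UU Q(4) comm)
    then have "U y \<bullet> y + Q y \<bullet> y = 0" by (metis inner_add_left inner_zero_left)
    with U(3)[of y] Q(3)[of y] have "U y \<bullet> y = 0" "Q y \<bullet> y = 0" by linarith+
    then have "U y = 0" "Q y = 0"
      using positive_form_zero[OF U(1-3)] positive_form_zero[OF Q(1-3)] by blast+
    then have "U x \<bullet> y - Q x \<bullet> y = 0" by (simp add: U(2) Q(2))
    then have "y \<bullet> y = 0" by (simp add: y_def inner_diff_left)
    then show "U x = Q x" by (simp add: y_def)
  qed
  from this[OF R refl] this[OF R' eq[symmetric]] show ?thesis by (rule trans[OF _ sym])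
qed

subsection \<open>Operators over the scalar field\<close>

lemma sc_cnj_one: "sc_cnj (1::'k::real_or_complex) = 1"
proof -
  have "sc_cnj 1 * sc_cnj (sc_cnj 1) = sc_cnj (1 * sc_cnj (1::'k))" by (simp only: sc_cnj_mult)
  then show ?thesis by (simp add: sc_cnj_cnj)
qed

lemma sc_re_scaleR_one: "sc_re (r *\<^sub>R (1::'k::real_or_complex)) = r"
proof -
  have "(2 * r) *\<^sub>R (1::'k) = (2 * sc_re (r *\<^sub>R (1::'k))) *\<^sub>R 1"
    using sc_add_cnj[of "r *\<^sub>R (1::'k)"]
    by (simp add: sc_cnj_scaleR sc_cnj_one flip: scaleR_add_left)
  then show ?thesis by simp
qed

lemma sc_re_add: "sc_re (x + y) = sc_re x + sc_re (y::'k::real_or_complex)"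
proof -
  have "(2 * sc_re (x + y)) *\<^sub>R (1::'k) = (2 * (sc_re x + sc_re y)) *\<^sub>R 1"
    unfolding sc_add_cnj[symmetric] distrib_left scaleR_add_left sc_cnj_add by (simp add: ac_simps)
  then show ?thesis by simp
qed

text \<open>The choice \<open>c = sc_cnj z\<close> turns the product into
  \<open>(norm z)\<^sup>2\<close>.\<close>

lemma sc_eq_zeroI:
  fixes z :: "'k::real_or_complex"
  assumes "\<And>c. sc_re (c * z) = 0"
  shows "z = 0"
proof -
  have "sc_re (sc_cnj z * z) = (norm z)\<^sup>2"
    by (simp only: mult.commute[of "sc_cnj z"] sc_mult_cnj sc_re_scaleR_one)
  with assms show ?thesis by simp
qed

context hilbert_space
begin

lemma ip_scale_right: "ip x (scale c y) = sc_cnj c * ip x y"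
  by (metis ip_commute ip_scale_left sc_cnj_mult)

text \<open>The real part of \<open>c * ip x y\<close> is \<open>scale c x \<bullet> y\<close>, so
  real inner products with all scalar multiples determine \<open>ip\<close>. Arguments can thus be
  carried out with \<open>\<bullet>\<close>.\<close>

lemma ip_eqI:
  assumes "\<And>c. scale c x \<bullet> y = scale c x' \<bullet> y'"
  shows "ip x y = ip x' y'"
proof -
  have "ip x y - ip x' y' = 0"
  proof (rule sc_eq_zeroI)
    fix c
    have "sc_re (c * (ip x y - ip x' y')) + sc_re (c * ip x' y') = sc_re (c * ip x y)"
      by (simp add: algebra_simps flip: sc_re_add)
    then show "sc_re (c * (ip x y - ip x' y')) = 0"
      using assms[of c] by (simp add: ip_scale_left[symmetric] re_ip)
  qed
  then show ?thesis by simp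
qed

text \<open>A scalar moves through \<open>f\<close>, so the real relation at all
  \<open>scale c x\<close> already contains the one for \<open>ip\<close>.\<close>

lemma inner_eq_iff_ip_eq:
  "(\<forall>x. f x \<bullet> y = x \<bullet> y') \<longleftrightarrow> (\<forall>x. ip (f x) y = ip x y')" if "Vector_Spaces.linear scale scale f"
proof
  interpret f: Vector_Spaces.linear scale scale f by fact
  assume "\<forall>x. f x \<bullet> y = x \<bullet> y'"
  then show "\<forall>x. ip (f x) y = ip x y'" by (intro allI ip_eqI) (simp flip: f.scale)
qed (metis re_ip)

lemma scale_inner_commute: "scale c x \<bullet> y = x \<bullet> scale (sc_cnj c) y"
  by (metis ip_scale_left ip_scale_right re_ip sc_cnj_cnj)

lemma bounded_linear_scale: "bounded_linear (scale c)"
proof (rule bounded_linear_intro[where K = "norm c"])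
  show "scale c (x + y) = scale c x + scale c y" for x y by (rule scale_right_distrib)
  show "scale c (r *\<^sub>R x) = r *\<^sub>R scale c x" for r x
    by (simp flip: scale_of_real add: mult.commute)
  show "norm (scale c x) \<le> norm x * norm c" for x
  proof -
    have "ip (scale c x) (scale c x) = (norm c)\<^sup>2 *\<^sub>R ip x x"
      by (metis ip_scale_left ip_scale_right mult.assoc mult_scaleR_left mult_1 sc_mult_cnj)
    then have "scale c x \<bullet> scale c x = sc_re (ip (scale (of_real ((norm c)\<^sup>2)) x) x)"
      by (simp add: ip_scale_left scaleR_conv_of_real flip: re_ip)
    then have "(norm (scale c x))\<^sup>2 = (norm x * norm c)\<^sup>2"
      by (simp add: re_ip scale_of_real power2_norm_eq_inner power_mult_distrib del: of_real_power)
    then show ?thesis by simp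
  qed
qed

section \<open>Bounded operators and adjoints\<close>

lemma bounded_ops_bounded_linear:
  assumes "C \<in> bounded_ops" shows "bounded_linear C"
proof -
  from assms interpret C: Vector_Spaces.linear scale scale C by (simp add: bounded_ops_def)
  obtain K where "\<And>x. norm (C x) \<le> K * norm x" using assms by (auto simp: bounded_ops_def)
  then show ?thesis
    by (intro bounded_linear_intro[where K = K])
      (simp_all add: C.add C.scale mult.commute flip: scale_of_real)
qed

lemma bounded_ops_scale:
  assumes "C \<in> bounded_ops" shows "C (scale c x) = scale c (C x)"
proof -
  from assms interpret C: Vector_Spaces.linear scale scale C by (simp add: bounded_ops_def)
  show ?thesis by (rule C.scale)
qed

lemma bounded_opsI:
  assumes C: "bounded_linear C" and "\<And>c x. C (scale c x) = scale c (C x)"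
  shows "C \<in> bounded_ops"
proof -
  interpret C: bounded_linear C by fact
  have "Vector_Spaces.linear scale scale C"
    by unfold_locales (simp_all add: C.add assms(2) scale_right_distrib scale_left_distrib)
  moreover obtain K where "\<And>x. norm (C x) \<le> norm x * K" using C.bounded by blast
  ultimately show ?thesis by (auto simp: bounded_ops_def mult.commute)
qed

lemma bounded_ops_compose:
  assumes "C \<in> bounded_ops" "D \<in> bounded_ops" shows "(\<lambda>x. C (D x)) \<in> bounded_ops"
  using assms by (intro bounded_opsI bounded_linear_compose[of C D])
    (simp_all add: bounded_ops_scale bounded_ops_bounded_linear)

lemma bounded_ops_add:
  assumes "C \<in> bounded_ops" "D \<in> bounded_ops" shows "(\<lambda>x. C x + D x) \<in> bounded_ops"
  using assms by (intro bounded_opsI bounded_linear_add)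
    (simp_all add: bounded_ops_scale bounded_ops_bounded_linear scale_right_distrib)

lemma bounded_ops_diff:
  assumes "C \<in> bounded_ops" "D \<in> bounded_ops" shows "(\<lambda>x. C x - D x) \<in> bounded_ops"
  using assms by (intro bounded_opsI bounded_linear_sub)
    (simp_all add: bounded_ops_scale bounded_ops_bounded_linear scale_right_diff_distrib)

lemma bounded_ops_ident: "(\<lambda>x. x) \<in> bounded_ops"
  by (intro bounded_opsI bounded_linear_ident) simp

lemma inner_eqI: "(\<And>x. x \<bullet> y = x \<bullet> z) \<Longrightarrow> y = (z::'a)"
  by (metis inner_diff_right inner_eq_zero_iff right_minus_eq)

lemma adjoint_exists:
  assumes C: "C \<in> bounded_ops"
  obtains D where "D \<in> bounded_ops" "\<And>x y. C x \<bullet> y = x \<bullet> D y"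
proof -
  interpret C: bounded_linear C by (rule bounded_ops_bounded_linear[OF C])
  have "\<exists>w. \<forall>x. w \<bullet> x = C x \<bullet> y" for y
  proof -
    have "bounded_linear (\<lambda>x. C x \<bullet> y)"
      by (rule bounded_linear_compose[OF bounded_linear_inner_left C.bounded_linear_axioms])
    from riesz_closed_subspace[OF this real_vector.subspace_UNIV closed_UNIV] show ?thesis by (metis UNIV_I)
  qed
  then obtain D where "\<And>x y. D y \<bullet> x = C x \<bullet> y" by metis
  then have D: "C x \<bullet> y = x \<bullet> D y" for x y by (simp add: inner_commute)
  obtain K where K: "0 < K" "\<And>x. norm (C x) \<le> norm x * K" using C.pos_bounded by blast
  have "bounded_linear D"
  proof (rule bounded_linear_intro[where K = K])
    show "D (x + y) = D x + D y" for x y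
      by (rule inner_eqI) (simp add: inner_add_right flip: D)
    show "D (r *\<^sub>R x) = r *\<^sub>R D x" for r x
      by (rule inner_eqI) (simp flip: D)
    show "norm (D y) \<le> norm y * K" for y
    proof -
      have "(norm (D y))\<^sup>2 = C (D y) \<bullet> y" by (simp add: D power2_norm_eq_inner)
      also have "\<dots> \<le> norm (C (D y)) * norm y" by (rule norm_cauchy_schwarz)
      also have "\<dots> \<le> norm (D y) * K * norm y" by (intro mult_right_mono K) simp
      finally have "norm (D y) * norm (D y) \<le> norm (D y) * (norm y * K)"
        by (simp add: power2_eq_square algebra_simps)
      then show ?thesis using K(1) by (cases "D y = 0") auto
    qed
  qed
  \<comment> \<open>Riesz representation gives only real linearity. The scalar is moved across the
    inner product as its conjugate, through \<open>C\<close>, and back.\<close>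
  moreover have "D (scale c y) = scale c (D y)" for c y
  proof (rule inner_eqI)
    fix x
    have "x \<bullet> D (scale c y) = scale (sc_cnj c) (C x) \<bullet> y"
      by (simp add: scale_inner_commute sc_cnj_cnj flip: D)
    also have "\<dots> = x \<bullet> scale c (D y)"
      by (simp add: D scale_inner_commute sc_cnj_cnj flip: bounded_ops_scale[OF C])
    finally show "x \<bullet> D (scale c y) = x \<bullet> scale c (D y)" .
  qed
  ultimately have "D \<in> bounded_ops" by (rule bounded_opsI)
  then show thesis using D by (rule that)
qed

text \<open>Replaces the definite description by a relation in the real inner product, which
  separates vectors and so gives uniqueness.\<close>

lemma adj_eqI:
  assumes C: "C \<in> bounded_ops" and D: "D \<in> bounded_ops" "\<And>x y. C x \<bullet> y = x \<bullet> D y"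
  shows "adj C = D"
  unfolding adj_def
proof (rule the_equality)
  have lin: "Vector_Spaces.linear scale scale C" using C by (simp add: bounded_ops_def)
  show "D \<in> bounded_ops \<and> (\<forall>x y. ip (C x) y = ip x (D y))"
    using D inner_eq_iff_ip_eq[OF lin] by blast
  fix D' assume "D' \<in> bounded_ops \<and> (\<forall>x y. ip (C x) y = ip x (D' y))"
  then have "x \<bullet> D' y = x \<bullet> D y" for x y by (metis D(2) re_ip)
  then show "D' = D" by (intro ext inner_eqI)
qed

section \<open>Self-adjointness, positivity and projections via the real inner product\<close>

lemma self_adjoint_iff:
  assumes C: "C \<in> bounded_ops"
  shows "adj C = C \<longleftrightarrow> (\<forall>x y. C x \<bullet> y = x \<bullet> C y)"
  by (metis C adj_eqI adjoint_exists)

lemma positive_op_iff: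
  "positive_op A \<longleftrightarrow> A \<in> bounded_ops \<and> (\<forall>x y. A x \<bullet> y = x \<bullet> A y) \<and> (\<forall>x. 0 \<le> A x \<bullet> x)"
  unfolding positive_op_def re_ip using self_adjoint_iff by blast

lemma projections_iff:
  "P \<in> projections \<longleftrightarrow> P \<in> bounded_ops \<and> (\<forall>x. P (P x) = P x) \<and> (\<forall>x y. P x \<bullet> y = x \<bullet> P y)"
  unfolding projections_def using self_adjoint_iff by (auto simp: fun_eq_iff)

lemma projection_exists:
  assumes M: "subspace M" "closed M"
  obtains Q where "Q \<in> projections" "\<And>x. Q x \<in> M" "\<And>x m. m \<in> M \<Longrightarrow> Q x \<bullet> m = x \<bullet> m"
proof -
  have M_real: "real_vector.subspace M"
    using subspace_scale[OF M(1), of _ "of_real _"] subspace_0[OF M(1)] subspace_add[OF M(1)]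
    by (auto simp: real_vector.subspace_def scale_of_real)
  have "\<exists>w\<in>M. \<forall>m\<in>M. w \<bullet> m = x \<bullet> m" for x
    by (rule riesz_closed_subspace[OF bounded_linear_inner_right M_real M(2)]) blast
  then obtain Q where QM: "\<And>x. Q x \<in> M" and Q: "\<And>x m. m \<in> M \<Longrightarrow> Q x \<bullet> m = x \<bullet> m" by metis
  \<comment> \<open>Linearity, homogeneity and idempotence of \<open>Q\<close> all follow by
    exhibiting a vector of \<open>M\<close> with the right inner products against
    \<open>M\<close>.\<close>
  have uniq: "Q x = y" if "y \<in> M" "\<And>m. m \<in> M \<Longrightarrow> y \<bullet> m = x \<bullet> m" for x y
  proof -
    have "Q x - y \<in> M" using M(1) QM that(1) by (rule subspace_diff)
    then have "(Q x - y) \<bullet> (Q x - y) = 0"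
      using Q[of "Q x - y" x] that(2)[of "Q x - y"] by (simp only: inner_diff_left)
    then show ?thesis by simp
  qed
  have "bounded_linear Q"
  proof (rule bounded_linear_intro[where K = 1])
    show "Q (x + y) = Q x + Q y" for x y
      by (rule uniq) (simp_all add: subspace_add[OF M(1)] QM inner_add_left Q)
    show "Q (r *\<^sub>R x) = r *\<^sub>R Q x" for r x
      by (rule uniq) (simp_all add: real_vector.subspace_scale[OF M_real] QM Q)
    show "norm (Q x) \<le> norm x * 1" for x
    proof -
      have "norm (Q x) * norm (Q x) = x \<bullet> Q x"
        using Q[OF QM, of x x] by (simp flip: power2_norm_eq_inner power2_eq_square)
      also have "\<dots> \<le> norm x * norm (Q x)" by (rule norm_cauchy_schwarz)
      finally show ?thesis by (cases "Q x = 0") auto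
    qed
  qed
  moreover have "Q (scale c x) = scale c (Q x)" for c x
    by (rule uniq) (simp_all add: subspace_scale[OF M(1)] QM scale_inner_commute Q)
  ultimately have "Q \<in> bounded_ops" by (rule bounded_opsI)
  moreover have "Q (Q x) = Q x" for x by (rule uniq) (simp_all add: QM)
  moreover have "Q x \<bullet> y = x \<bullet> Q y" for x y
    using Q[OF QM, of x y] Q[OF QM, of y x] by (simp add: inner_commute)
  ultimately have "Q \<in> projections" by (simp add: projections_iff)
  then show thesis by (rule that[OF _ QM Q])
qed

section \<open>Square roots of operators\<close>

lemma op_sqrt_exists:
  assumes "positive_op S"
  obtains R where "positive_op R" "\<And>x. R (R x) = S x"
    "\<forall>C. bounded_linear C \<longrightarrow> C \<circ> S = S \<circ> C \<longrightarrow> C \<circ> R = R \<circ> C"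
proof -
  have S: "S \<in> bounded_ops" "\<And>x y. S x \<bullet> y = x \<bullet> S y" "\<And>x. 0 \<le> S x \<bullet> x"
    using assms by (auto simp: positive_op_iff)
  obtain R where R: "bounded_linear R" "\<And>x y. R x \<bullet> y = x \<bullet> R y" "\<And>x. 0 \<le> R x \<bullet> x"
    "\<And>x. R (R x) = S x"
    "\<forall>C. bounded_linear C \<longrightarrow> C \<circ> S = S \<circ> C \<longrightarrow> C \<circ> R = R \<circ> C"
    by (rule positive_sqrt_exists[OF bounded_ops_bounded_linear[OF S(1)] S(2,3)]) (rule that)
  \<comment> \<open>The real root is homogeneous over \<open>'k\<close> because it commutes with
    everything that commutes with \<open>S\<close>, in particular with each
    \<open>scale c\<close>.\<close>
  have "scale c \<circ> S = S \<circ> scale c" for c by (simp add: fun_eq_iff bounded_ops_scale[OF S(1)])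
  with R(5) bounded_linear_scale have "scale c \<circ> R = R \<circ> scale c" for c by blast
  then have "R (scale c x) = scale c (R x)" for c x by (metis comp_apply)
  then have "R \<in> bounded_ops" by (rule bounded_opsI[OF R(1)])
  then have "positive_op R" using R(2,3) by (simp add: positive_op_iff)
  then show thesis using R(4,5) by (rule that)
qed

lemma op_sqrt_eqI:
  assumes "positive_op R" "\<And>x. R (R x) = S x"
  shows "op_sqrt S = R"
  unfolding op_sqrt_def
proof (rule the_equality)
  show "positive_op R \<and> R \<circ> R = S" using assms by auto
  fix R' assume R': "positive_op R' \<and> R' \<circ> R' = S"
  have sq: "R' (R' x) = R (R x)" for x using R' assms(2)[of x] by auto
  have R'_pos: "positive_op R'" using R' by (rule conjunct1)
  have pos: "bounded_linear U" "\<And>x y. U x \<bullet> y = x \<bullet> U y" "\<And>x. 0 \<le> U x \<bullet> x"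
    if "positive_op U" for U
    using that bounded_ops_bounded_linear[of U] unfolding positive_op_iff by blast+
  show "R' = R"
    by (rule positive_sqrt_unique[OF pos[OF R'_pos] pos[OF assms(1)] sq])
qed

lemma op_sqrt_square:
  assumes "positive_op S"
  shows "op_sqrt S (op_sqrt S x) = S x"
proof -
  obtain R where R: "positive_op R" "\<And>x. R (R x) = S x"
    by (rule op_sqrt_exists[OF assms]) (rule that)
  show ?thesis unfolding op_sqrt_eqI[OF R] by (rule R(2))
qed

section \<open>Projections onto closed ranges and their compressions\<close>

lemma subspace_closure_range:
  assumes L: "L \<in> bounded_ops"
  shows "subspace (closure (range L))"
proof (rule subspaceI)
  interpret L: bounded_linear L by (rule bounded_ops_bounded_linear[OF L])
  have "L 0 = 0" by (rule L.zero)
  then show "0 \<in> closure (range L)" by (metis closure_subset rangeI subsetD)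
next
  interpret L: bounded_linear L by (rule bounded_ops_bounded_linear[OF L])
  fix x y assume "x \<in> closure (range L)" "y \<in> closure (range L)"
  then obtain f g where f: "\<And>n. f n \<in> range L" "f \<longlonglongrightarrow> x" and g: "\<And>n. g n \<in> range L" "g \<longlonglongrightarrow> y"
    by (auto simp: closure_sequential)
  have "f n + g n \<in> closure (range L)" for n
  proof -
    obtain u v where "f n = L u" "g n = L v" using f(1)[of n] g(1)[of n] by blast
    then have "f n + g n = L (u + v)" by (simp add: L.add)
    then show ?thesis by (simp add: closure_subset[THEN subsetD])
  qed
  then show "x + y \<in> closure (range L)"
    by (rule closed_sequentially[OF closed_closure _ tendsto_add[OF f(2) g(2)]])
next
  fix c x assume "x \<in> closure (range L)"
  then obtain f where f: "\<And>n. f n \<in> range L" "f \<longlonglongrightarrow> x" by (auto simp: closure_sequential)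
  have "scale c (f n) \<in> closure (range L)" for n
  proof -
    obtain u where "f n = L u" using f(1)[of n] by blast
    then have "scale c (f n) = L (scale c u)" by (simp add: bounded_ops_scale[OF L])
    then show ?thesis by (simp add: closure_subset[THEN subsetD])
  qed
  then show "scale c x \<in> closure (range L)"
    by (rule closed_sequentially[OF closed_closure _ bounded_linear.tendsto[OF bounded_linear_scale f(2)]])
qed

text \<open>The hypothesis on \<open>w\<close> is the normal equation
  \<open>L\<^sup>* L w = L\<^sup>* x\<close>. Orthogonality of \<open>x - L w\<close> to
  \<open>range L\<close> extends to the closure, since a hyperplane is closed. The last clause is
  the case \<open>w = 0\<close>.\<close>

lemma range_projection_exists:
  assumes L: "L \<in> bounded_ops"
  obtains Q where "Q \<in> projections" "\<And>x w. (\<And>y. L w \<bullet> L y = x \<bullet> L y) \<Longrightarrow> Q x = L w"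
    "\<And>x. (\<And>y. x \<bullet> L y = 0) \<Longrightarrow> Q x = 0"
proof -
  let ?M = "closure (range L)"
  obtain Q where Q: "Q \<in> projections" "\<And>x. Q x \<in> ?M" "\<And>x m. m \<in> ?M \<Longrightarrow> Q x \<bullet> m = x \<bullet> m"
    by (rule projection_exists[OF subspace_closure_range[OF L] closed_closure]) blast
  have eq: "Q x = L w" if *: "\<And>y. L w \<bullet> L y = x \<bullet> L y" for x w
  proof -
    have "(x - L w) \<bullet> m = 0" if "m \<in> ?M" for m
    proof -
      have "closure (range L) \<subseteq> {m. (x - L w) \<bullet> m = 0}"
        by (rule closure_minimal[OF _ closed_hyperplane]) (auto simp: inner_diff_left *)
      with that show ?thesis by blast
    qed
    moreover have Lw: "L w \<in> ?M" by (rule subsetD[OF closure_subset rangeI])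
    have "Q x - L w \<in> ?M"
      by (rule subspace_diff[OF subspace_closure_range[OF L] Q(2) Lw])
    ultimately have "(Q x - L w) \<bullet> (Q x - L w) = 0"
      using Q(3)[of "Q x - L w" x] by (simp add: inner_diff_left)
    then show ?thesis by simp
  qed
  interpret L: bounded_linear L by (rule bounded_ops_bounded_linear[OF L])
  have "Q x = 0" if "\<And>y. x \<bullet> L y = 0" for x
    using eq[of 0 x] that by (simp add: L.zero)
  with Q(1) eq show thesis by (rule that)
qed

text \<open>
  With \<open>L = D + Y\<close>, the projection \<open>Q\<close> onto the closed range of \<open>L\<close> sends \<open>P N v\<close> to \<open>L D v\<close>, because
  \<open>L\<^sup>* L = N\<close> and \<open>P L = D\<close>; hence \<open>P Q P N = D\<^sup>2 = B N\<close>. On \<open>ker N\<close> both \<open>P Q P\<close> and \<open>B\<close> vanish.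
\<close>
lemma compression_of_projection:
  assumes P: "P \<in> projections"
    and B: "B \<in> bounded_ops" "\<And>x y. B x \<bullet> y = x \<bullet> B y"
    and N: "\<And>x y. N x \<bullet> y = x \<bullet> N y" "\<And>x. P (N x) = N x" "\<And>x. N x = 0 \<Longrightarrow> B x = 0"
    and D: "D \<in> bounded_ops" "\<And>x y. D x \<bullet> y = x \<bullet> D y" "\<And>x. P (D x) = D x"
      "\<And>x. D (D x) = B (N x)" "\<And>x. D (N x) = N (D x)"
    and Y: "Y \<in> bounded_ops" "\<And>x. P (Y x) = 0"
    and gram: "\<And>x y. D x \<bullet> D y + Y x \<bullet> Y y = N x \<bullet> y"
  shows "B \<in> proj_triple_products"
proof -
  have P': "P \<in> bounded_ops" "\<And>x. P (P x) = P x" "\<And>x y. P x \<bullet> y = x \<bullet> P y"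
    using P by (auto simp: projections_iff)
  interpret P: bounded_linear P by (rule bounded_ops_bounded_linear[OF P'(1)])
  define L where "L x = D x + Y x" for x
  have L: "L \<in> bounded_ops" unfolding L_def using D(1) Y(1) by (rule bounded_ops_add)
  have PL: "P (L x) = D x" for x by (simp add: L_def P.add D(3) Y(2))
  have LL: "L x \<bullet> L y = N x \<bullet> y" for x y
  proof -
    \<comment> \<open>\<open>P\<close> fixes \<open>D u\<close> and annihilates \<open>Y v\<close>,
      so the cross terms of the Gram form vanish.\<close>
    have "D u \<bullet> Y v = 0" for u v
      using P'(3)[of "D u" "Y v"] by (simp add: D(3) Y(2))
    from this[of x y] this[of y x] show ?thesis
      by (simp add: L_def inner_add_left inner_add_right inner_commute[of "Y x" "D y"] flip: gram)
  qed
  obtain Q where Q: "Q \<in> projections" "\<And>x w. (\<And>y. L w \<bullet> L y = x \<bullet> L y) \<Longrightarrow> Q x = L w"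
    "\<And>x. (\<And>y. x \<bullet> L y = 0) \<Longrightarrow> Q x = 0"
    by (rule range_projection_exists[OF L]) blast
  have Q': "Q \<in> bounded_ops" "\<And>x y. Q x \<bullet> y = x \<bullet> Q y"
    using Q(1) by (auto simp: projections_iff)
  define E where "E x = P (Q (P x)) - B x" for x
  have Esym: "E x \<bullet> y = x \<bullet> E y" for x y
    by (simp add: E_def inner_diff_left inner_diff_right P'(3) Q'(2) B(2))
  have EN: "E (N x) = 0" for x
  proof -
    \<comment> \<open>Both sides of the normal equation equal \<open>D (N x) \<bullet> y\<close>:
      one by \<open>L\<^sup>* L = N\<close> and commutation, the other by
      \<open>P L = D\<close>.\<close>
    have "Q (P (N x)) = L (D x)"
    proof (rule Q(2))
      show "L (D x) \<bullet> L y = P (N x) \<bullet> L y" for y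
        by (simp add: LL P'(3) PL flip: D(2,5))
    qed
    then show ?thesis by (simp add: E_def PL D(4))
  qed
  have "E x = 0" for x
  proof -
    \<comment> \<open>\<open>E\<close> is symmetric and vanishes on the range of \<open>N\<close>,
      so its values lie in the kernel of \<open>N\<close>. There \<open>E\<close> vanishes too,
      hence \<open>E\<^sup>2 = 0\<close> and \<open>E = 0\<close>.\<close>
    let ?e = "E x"
    have "N ?e \<bullet> y = 0" for y by (simp add: N(1) Esym EN)
    from this[of "N ?e"] have Ne: "N ?e = 0" by simp
    then have Be: "B ?e = 0" by (rule N(3))
    have "D ?e \<bullet> D ?e = 0"
      using B(2)[of ?e 0] Be by (simp add: D(2,4) Ne)
    then have De: "D ?e = 0" by simp
    have "Q (P ?e) = 0"
      by (rule Q(3)) (simp add: P'(3) PL De flip: D(2))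
    then have "E ?e = 0" unfolding E_def[of ?e] by (simp add: Be P.zero)
    then have "?e \<bullet> ?e = 0" by (metis Esym inner_zero_right)
    then show ?thesis by simp
  qed
  then have "P \<circ> Q \<circ> P = B" by (auto simp: E_def fun_eq_iff)
  with P Q(1) show ?thesis by (auto simp: proj_triple_products_def)
qed

text \<open>For roots known only through their squares: \<open>S\<^sup>2\<close> kills
  \<open>P x - x\<close>, so by symmetry \<open>S\<close> does, and the adjoint of
  \<open>S P = S\<close> is \<open>P S = S\<close>.\<close>

lemma fixed_by_projection:
  assumes P: "P \<in> projections"
    and S: "S \<in> bounded_ops" "\<And>x y. S x \<bullet> y = x \<bullet> S y" and "\<And>x. S (S (P x)) = S (S x)"
  shows "S (P x) = S x" "P (S x) = S x"
proof -
  interpret S: bounded_linear S by (rule bounded_ops_bounded_linear[OF S(1)])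
  have SP: "S (P x) = S x" for x
  proof -
    let ?y = "P x - x"
    have "S (S ?y) = 0" using assms(4) by (simp add: S.diff)
    then have "S ?y \<bullet> S ?y = 0" by (simp add: S(2))
    then show ?thesis by (simp add: S.diff)
  qed
  then show "S (P x) = S x" .
  show "P (S x) = S x"
  proof (rule inner_eqI)
    fix y
    have "y \<bullet> P (S x) = P y \<bullet> S x" using P by (simp add: projections_iff)
    also have "\<dots> = S (P y) \<bullet> x" by (simp add: S(2))
    also have "\<dots> = y \<bullet> S x" by (simp add: SP S(2))
    finally show "y \<bullet> P (S x) = y \<bullet> S x" .
  qed
qed

text \<open>The Gram form of the corner \<open>(1 - P) Q P\<close> is \<open>A - A\<^sup>2\<close>
  for \<open>A = P Q P\<close>, because \<open>Q\<close> is idempotent and \<open>P Q P\<close> is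
  the part of \<open>Q P\<close> in the range of \<open>P\<close>.\<close>

lemma defect_inner:
  assumes P: "P \<in> projections" and Q: "Q \<in> projections"
  shows "(Q (P x) - P (Q (P x))) \<bullet> (Q (P y) - P (Q (P y)))
    = (P (Q (P x)) - P (Q (P (P (Q (P x)))))) \<bullet> y"
  using assms by (auto simp: projections_iff inner_diff_left inner_diff_right)

subsection \<open>Products of projections\<close>

lemma triple_product_positive:
  assumes "P \<in> projections" "Q \<in> projections"
  shows "positive_op (P \<circ> Q \<circ> P)"
proof -
  have P: "P \<in> bounded_ops" "\<And>x. P (P x) = P x" "\<And>x y. P x \<bullet> y = x \<bullet> P y"
    and Q: "Q \<in> bounded_ops" "\<And>x. Q (Q x) = Q x" "\<And>x y. Q x \<bullet> y = x \<bullet> Q y"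
    using assms by (auto simp: projections_iff)
  have "(\<lambda>x. P (Q (P x))) \<in> bounded_ops" by (rule bounded_ops_compose[OF P(1) bounded_ops_compose[OF Q(1) P(1)]])
  moreover have "P (Q (P x)) \<bullet> y = x \<bullet> P (Q (P y))" for x y by (simp add: P(3) Q(3))
  moreover have "0 \<le> P (Q (P x)) \<bullet> x" for x
  proof -
    have "P (Q (P x)) \<bullet> x = Q (P x) \<bullet> Q (P x)" by (simp add: P(3) Q(2,3))
    then show ?thesis by simp
  qed
  ultimately show ?thesis by (simp add: positive_op_iff o_def)
qed

text \<open>For \<open>T = P Q\<close> one has \<open>T T\<^sup>* = P Q Q P = P Q P\<close>.\<close>

lemma op_abs_adj_proj_product:
  assumes "P \<in> projections" "Q \<in> projections"
  shows "op_abs (adj (P \<circ> Q)) = op_sqrt (P \<circ> Q \<circ> P)"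
proof -
  have P: "P \<in> bounded_ops" "\<And>x y. P x \<bullet> y = x \<bullet> P y"
    and Q: "Q \<in> bounded_ops" "\<And>x. Q (Q x) = Q x" "\<And>x y. Q x \<bullet> y = x \<bullet> Q y"
    using assms by (auto simp: projections_iff)
  have PQ: "P \<circ> Q \<in> bounded_ops" and QP: "Q \<circ> P \<in> bounded_ops"
    using P(1) Q(1) by (simp_all add: o_def bounded_ops_compose)
  have "adj (P \<circ> Q) = Q \<circ> P" by (rule adj_eqI[OF PQ QP]) (simp add: P Q)
  moreover have "adj (Q \<circ> P) = P \<circ> Q" by (rule adj_eqI[OF QP PQ]) (simp add: P Q)
  ultimately show ?thesis by (simp add: op_abs_def o_def Q(2))
qed

text \<open>\<open>A\<^sup>3 + A\<^sup>4\<close> is the product \<open>B N\<close> in both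
  applications of \<open>compression_of_projection\<close>: \<open>B = A\<close> with
  \<open>N = A\<^sup>2 + A\<^sup>3\<close>, and \<open>B = A\<^sup>2\<close> with
  \<open>N = A + A\<^sup>2\<close>.\<close>

lemma sqrt_cube_plus_fourth_exists:
  assumes "positive_op A"
  obtains D where "positive_op D" "\<And>x. D (D x) = A (A (A x)) + A (A (A (A x)))"
    "\<And>x. A (D x) = D (A x)"
proof -
  have A: "A \<in> bounded_ops" "\<And>x y. A x \<bullet> y = x \<bullet> A y" "\<And>x. 0 \<le> A x \<bullet> x"
    using assms by (auto simp: positive_op_iff)
  interpret A: bounded_linear A by (rule bounded_ops_bounded_linear[OF A(1)])
  define S where "S x = A (A (A x)) + A (A (A (A x)))" for x
  note AA = bounded_ops_compose[OF A(1) A(1)]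
  have "S \<in> bounded_ops"
    unfolding S_def by (intro bounded_ops_add bounded_ops_compose[OF A(1) AA] bounded_ops_compose[OF AA AA])
  moreover have "S x \<bullet> y = x \<bullet> S y" for x y
    by (simp add: S_def inner_add_left inner_add_right A(2))
  moreover have "0 \<le> S x \<bullet> x" for x
  proof -
    have "S x \<bullet> x = A (A x) \<bullet> A x + A (A x) \<bullet> A (A x)"
      by (simp add: S_def inner_add_left A(2))
    then show ?thesis using A(3)[of "A x"] by simp
  qed
  ultimately have "positive_op S" by (simp add: positive_op_iff)
  then obtain D where D: "positive_op D" "\<And>x. D (D x) = S x"
    "\<forall>C. bounded_linear C \<longrightarrow> C \<circ> S = S \<circ> C \<longrightarrow> C \<circ> D = D \<circ> C"
    by (rule op_sqrt_exists) (rule that)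
  have "A \<circ> S = S \<circ> A" by (simp add: fun_eq_iff S_def A.add)
  with D(3) A.bounded_linear_axioms have "A \<circ> D = D \<circ> A" by blast
  then have "A (D x) = D (A x)" for x by (simp add: fun_eq_iff)
  with D(1) D(2)[unfolded S_def] show thesis by (rule that)
qed

text \<open>The given compression is \<open>A\<^sup>2\<close>, so the corner \<open>Y\<close> of
  \<open>Q\<close> has Gram form \<open>A\<^sup>2 - A\<^sup>4\<close>. Adding
  \<open>D\<^sup>2 = A\<^sup>3 + A\<^sup>4\<close> cancels the fourth power and leaves
  \<open>N\<close>.\<close>

lemma sqrt_is_triple_product:
  assumes A: "positive_op A" and P: "P \<in> projections" and Q: "Q \<in> projections"
    and sq: "\<And>x. A (A x) = P (Q (P x))"
  shows "A \<in> proj_triple_products"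
proof -
  have A': "A \<in> bounded_ops" "\<And>x y. A x \<bullet> y = x \<bullet> A y" "\<And>x. 0 \<le> A x \<bullet> x"
    using A by (auto simp: positive_op_iff)
  have P': "P \<in> bounded_ops" "\<And>x. P (P x) = P x" using P by (auto simp: projections_iff)
  have Q': "Q \<in> bounded_ops" using Q by (auto simp: projections_iff)
  interpret A: bounded_linear A by (rule bounded_ops_bounded_linear[OF A'(1)])
  interpret P: bounded_linear P by (rule bounded_ops_bounded_linear[OF P'(1)])
  obtain D where D: "positive_op D" "\<And>x. D (D x) = A (A (A x)) + A (A (A (A x)))"
    "\<And>x. A (D x) = D (A x)"
    by (rule sqrt_cube_plus_fourth_exists[OF A]) (rule that)
  have D': "D \<in> bounded_ops" "\<And>x y. D x \<bullet> y = x \<bullet> D y"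
    using D(1) by (auto simp: positive_op_iff)
  interpret D: bounded_linear D by (rule bounded_ops_bounded_linear[OF D'(1)])
  have "A (A (P x)) = A (A x)" for x by (simp add: sq P'(2))
  note PA = fixed_by_projection[OF P A'(1,2) this]
  have "D (D (P x)) = D (D x)" for x by (simp add: D(2) PA)
  note PD = fixed_by_projection[OF P D' this]
  define N where "N x = A (A x) + A (A (A x))" for x
  define Y where "Y x = Q (P x) - P (Q (P x))" for x
  show ?thesis
  proof (rule compression_of_projection[where N = N and D = D and Y = Y, OF P A'(1,2) _ _ _ D'])
    show "N x \<bullet> y = x \<bullet> N y" for x y
      by (simp add: N_def inner_add_left inner_add_right A'(2))
    show "P (N x) = N x" for x by (simp add: N_def P.add PA)
    show "A x = 0" if "N x = 0" for x
    proof -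
      \<comment> \<open>Both summands of \<open>N x \<bullet> x\<close> are nonnegative, so
        \<open>N x = 0\<close> forces \<open>A x = 0\<close>.\<close>
      have "A x \<bullet> A x + A (A x) \<bullet> A x = N x \<bullet> x"
        by (simp add: N_def inner_add_left A'(2))
      with that have "A x \<bullet> A x + A (A x) \<bullet> A x = 0" by simp
      with A'(3)[of "A x"] inner_ge_zero[of "A x"] have "A x \<bullet> A x = 0" by linarith
      then show ?thesis by simp
    qed
    show "P (D x) = D x" for x by (rule PD)
    show "D (D x) = A (N x)" for x by (simp add: D(2) N_def A.add)
    show "D (N x) = N (D x)" for x by (simp add: N_def D.add D(3))
    note QP = bounded_ops_compose[OF Q' P'(1)]
    show "Y \<in> bounded_ops"
      unfolding Y_def by (rule bounded_ops_diff[OF QP bounded_ops_compose[OF P'(1) QP]])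
    show "P (Y x) = 0" for x by (simp add: Y_def P.diff P'(2))
    show "D x \<bullet> D y + Y x \<bullet> Y y = N x \<bullet> y" for x y
    proof -
      have "D x \<bullet> D y = (A (A (A x)) + A (A (A (A x)))) \<bullet> y" by (simp add: D'(2) flip: D(2))
      moreover have "Y x \<bullet> Y y = (A (A x) - A (A (A (A x)))) \<bullet> y"
        by (simp only: Y_def defect_inner[OF P Q] sq)
      ultimately show ?thesis by (simp add: N_def inner_add_left inner_diff_left)
    qed
  qed
qed

text \<open>
  The factor \<open>1 + A\<close> in \<open>Y\<close> comes from \<open>A\<^sup>2 - A\<^sup>4 = A (1 + A) (A - A\<^sup>2)\<close>, which relates the corner needed
  for \<open>A\<^sup>2\<close> to that of \<open>Q\<close>.
\<close>
lemma square_is_triple_product: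
  assumes P: "P \<in> projections" and Q: "Q \<in> projections"
    and A: "\<And>x. A x = P (Q (P x))"
  shows "A \<circ> A \<in> proj_triple_products"
proof -
  have "A = P \<circ> Q \<circ> P" by (simp add: fun_eq_iff A)
  with triple_product_positive[OF P Q] have A_pos: "positive_op A" by simp
  then have A': "A \<in> bounded_ops" "\<And>x y. A x \<bullet> y = x \<bullet> A y" "\<And>x. 0 \<le> A x \<bullet> x"
    by (auto simp: positive_op_iff)
  have P': "P \<in> bounded_ops" "\<And>x. P (P x) = P x" using P by (auto simp: projections_iff)
  have Q': "Q \<in> bounded_ops" using Q by (auto simp: projections_iff)
  interpret A: bounded_linear A by (rule bounded_ops_bounded_linear[OF A'(1)])
  interpret P: bounded_linear P by (rule bounded_ops_bounded_linear[OF P'(1)])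
  obtain D where D: "positive_op D" "\<And>x. D (D x) = A (A (A x)) + A (A (A (A x)))"
    "\<And>x. A (D x) = D (A x)"
    by (rule sqrt_cube_plus_fourth_exists[OF A_pos]) (rule that)
  have D': "D \<in> bounded_ops" "\<And>x y. D x \<bullet> y = x \<bullet> D y"
    using D(1) by (auto simp: positive_op_iff)
  interpret D: bounded_linear D by (rule bounded_ops_bounded_linear[OF D'(1)])
  have PA: "P (A x) = A x" "A (P x) = A x" for x by (simp_all add: A P'(2))
  have "D (D (P x)) = D (D x)" for x by (simp add: D(2) PA)
  note PD = fixed_by_projection[OF P D' this]
  \<comment> \<open>Here \<open>B = A\<^sup>2\<close>, and \<open>D\<^sup>2 = B N\<close> dictates
    \<open>N\<close>. The Gram form of \<open>Y\<close> is \<open>(1 + A) (A - A\<^sup>2) (1 + A) =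
    A + A\<^sup>2 - A\<^sup>3 - A\<^sup>4\<close>, which \<open>D\<^sup>2\<close> completes to
    \<open>N\<close>.\<close>
  define N where "N x = A x + A (A x)" for x
  define Y where "Y x = Q (P (x + A x)) - P (Q (P (x + A x)))" for x
  show ?thesis
  proof (rule compression_of_projection[where N = N and D = D and Y = Y, OF P _ _ _ _ _ D'])
    show "A \<circ> A \<in> bounded_ops" using A'(1) by (simp add: o_def bounded_ops_compose)
    show "(A \<circ> A) x \<bullet> y = x \<bullet> (A \<circ> A) y" for x y by (simp add: A'(2))
    show "N x \<bullet> y = x \<bullet> N y" for x y
      by (simp add: N_def inner_add_left inner_add_right A'(2))
    show "P (N x) = N x" for x by (simp add: N_def P.add PA)
    show "(A \<circ> A) x = 0" if "N x = 0" for x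
    proof -
      have "A x \<bullet> A x + A x \<bullet> x = N x \<bullet> x"
        by (simp add: N_def inner_add_left A'(2))
      with that have "A x \<bullet> A x + A x \<bullet> x = 0" by simp
      with A'(3)[of x] inner_ge_zero[of "A x"] have "A x \<bullet> A x = 0" by linarith
      then show ?thesis by (simp add: A.zero)
    qed
    show "P (D x) = D x" for x by (rule PD)
    show "D (D x) = (A \<circ> A) (N x)" for x by (simp add: D(2) N_def A.add)
    show "D (N x) = N (D x)" for x by (simp add: N_def D.add D(3))
    note QP = bounded_ops_compose[OF bounded_ops_compose[OF Q' P'(1)] bounded_ops_add[OF bounded_ops_ident A'(1)]]
    show "Y \<in> bounded_ops"
      unfolding Y_def by (rule bounded_ops_diff[OF QP bounded_ops_compose[OF P'(1) QP]])
    show "P (Y x) = 0" for x by (simp add: Y_def P.diff P'(2))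
    show "D x \<bullet> D y + Y x \<bullet> Y y = N x \<bullet> y" for x y
    proof -
      have "D x \<bullet> D y = (A (A (A x)) + A (A (A (A x)))) \<bullet> y" by (simp add: D'(2) flip: D(2))
      moreover have "Y x \<bullet> Y y = (A (x + A x) - A (A (x + A x))) \<bullet> (y + A y)"
        by (simp only: Y_def defect_inner[OF P Q] A)
      moreover have "\<dots> = (A x - A (A (A x))) \<bullet> y + (A (A x) - A (A (A (A x)))) \<bullet> y"
        by (simp add: A.add inner_add_left inner_diff_left inner_add_right A'(2))
      ultimately show ?thesis by (simp add: N_def inner_add_left inner_diff_left)
    qed
  qed
qed

text \<open>The left side consists of the positive roots of compressions, so one inclusion is
  closure of compressions under roots. The other is closure under squares, since a positive
  \<open>A\<close> is the unique positive root of \<open>A \<circ> A\<close>.\<close>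

lemma proj_products_plus_eq_triple_products: "proj_products_plus = proj_triple_products"
proof (intro set_eqI iffI)
  fix A assume "A \<in> proj_products_plus"
  then obtain P Q where A: "positive_op A" and P: "P \<in> projections" and Q: "Q \<in> projections"
    and "A = op_abs (adj (P \<circ> Q))"
    by (auto simp: proj_products_plus_def proj_products_def)
  then have "A = op_sqrt (P \<circ> Q \<circ> P)" by (simp add: op_abs_adj_proj_product)
  with op_sqrt_square[OF triple_product_positive[OF P Q]]
  have "A (A x) = P (Q (P x))" for x by simp
  then show "A \<in> proj_triple_products" by (rule sqrt_is_triple_product[OF A P Q])
next
  fix A assume "A \<in> proj_triple_products"
  then obtain P Q where P: "P \<in> projections" and Q: "Q \<in> projections" and A: "A = P \<circ> Q \<circ> P"
    by (auto simp: proj_triple_products_def)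
  have pos: "positive_op A" unfolding A by (rule triple_product_positive[OF P Q])
  have "A \<circ> A \<in> proj_triple_products"
    by (rule square_is_triple_product[OF P Q]) (simp add: A)
  then obtain P' Q' where P': "P' \<in> projections" and Q': "Q' \<in> projections"
    and sq: "A \<circ> A = P' \<circ> Q' \<circ> P'"
    by (auto simp: proj_triple_products_def)
  have "op_abs (adj (P' \<circ> Q')) = op_sqrt (A \<circ> A)"
    unfolding sq by (rule op_abs_adj_proj_product[OF P' Q'])
  also have "\<dots> = A" by (rule op_sqrt_eqI[OF pos]) simp
  finally show "A \<in> proj_products_plus"
    using pos P' Q' by (auto simp: proj_products_plus_def proj_products_def)
qed

end

theorem proposition5p5:
  fixes scale :: "'k::real_or_complex \<Rightarrow> 'a::{real_inner, complete_space} \<Rightarrow> 'a"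
    and ip :: "'a \<Rightarrow> 'a \<Rightarrow> 'k"
  assumes "hilbert_space scale ip"
  shows "hilbert_space.proj_products_plus scale ip = hilbert_space.proj_triple_products scale ip"
  using hilbert_space.proj_products_plus_eq_triple_products[OF assms] .

end
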